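(* Let $p_A,p_B\in(0,1)$, let $\mu_A,\mu_B\ge0$ be real numbers, and let $J,r,s$ be integers. Let $D$ be a finite pattern of $A$s and $B$s containing exactly $r$ $A$s and exactly $s$ $B$s, and let $\mu_A^*,\mu_B^*,\mu_D^*$ be defined as in the context. If $p_A\neq p_B$, $J\ge2$ and $r,s\ge1$, and if $r+s$ divides $J$, then the Parrondo effect is present for the nonrandom-pattern strategy with pattern $D$, that is, $$\mu_D^*<\frac{r\mu_A^*+s\mu_B^*}{r+s}.$$
   Context: A two-armed slot machine has arms $A$ and $B$. Excluding the Futurity award, the payouts from each arm are nonnegative and i.i.d.; arm $A$ (resp. $B$) has probability $p_A$ (resp. $p_B$) of a nonzero payout and mean payout $\mu_A$ (resp. $\mu_B$). After $J$ consecutive losses (zero payouts), regardless of the order of play of the two arms, the $J$ lost coins are returned to the player (the Futurity award). Let $q_A:=1-p_A$, $q_B:=1-p_B$. The asymptotic mean payouts per coup, including the Futurity award, from playing arm $A$ only and arm $B$ only are $$\mu_A^*:=\mu_A+J\frac{p_Aq_A^J}{1-q_A^J},\qquad \mu_B^*:=\mu_B+J\frac{p_Bq_B^J}{1-q_B^J}.$$ The nonrandom-pattern strategy with pattern $D$ (a finite sequence of $A$s and $B$s, with $r\ge1$ $A$s and $s\ge1$ $B$s) plays the arms in the order of $D$, repeated ad infinitum. Its asymptotic mean payout per coup, including the Futurity award, is $$\mu_D^*:=\frac{r\mu_A+s\mu_B}{r+s}+Jp_D^\circ,$$ where $p_D^\circ$ is the asymptotic frequency of Futurity awards; when $r+s$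 divides $J$ it is given by $$p_D^\circ:=\frac{rp_A+sp_B}{r+s}\left(\frac{(q_A^rq_B^s)^{J/(r+s)}}{1-(q_A^rq_B^s)^{J/(r+s)}}\right).$$ The Parrondo effect is said to be present for the nonrandom-pattern strategy with pattern $D$ if $\mu_D^*<(r\mu_A^*+s\mu_B^* )/(r+s)$. *)

theory Defs
  imports Complex_Main
begin

datatype arm = A | B

text \<open>
  Throughout, \<open>p x\<close> is the probability of a nonzero payout from arm \<open>x\<close>, so that
  \<open>q x = 1 - p x\<close>, and \<open>\<mu> x\<close> is the mean payout from arm \<open>x\<close> excluding the Futurity award.
  A pattern is a list of arms, played cyclically.
\<close>

definition arm_mean_payout :: "nat \<Rightarrow> (arm \<Rightarrow> real) \<Rightarrow> (arm \<Rightarrow> real) \<Rightarrow> arm \<Rightarrow> real" where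
  "arm_mean_payout J p \<mu> x =
    (let q = 1 - p x in \<mu> x + real J * (p x * q ^ J / (1 - q ^ J)))"

text \<open>
  The asymptotic frequency of Futurity awards under a pattern whose length divides \<open>J\<close>.
  The closed form below is valid only in that case (there it depends on the pattern only through
  the numbers of \<open>A\<close>s and \<open>B\<close>s, and \<open>div\<close> is exact division); when the length of the pattern
  does not divide \<open>J\<close>, the value is without significance.
\<close>

definition futurity_freq :: "nat \<Rightarrow> (arm \<Rightarrow> real) \<Rightarrow> arm list \<Rightarrow> real" where
  "futurity_freq J p D =
    (let r = count_list D A; s = count_list D B;
         qA = 1 - p A; qB = 1 - p B;
         Q = (qA ^ r * qB ^ s) ^ (J div (r + s))
     in (real r * p A + real s * p B) / real (r + s) * (Q / (1 - Q)))"

definition pattern_mean_payout ::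
    "nat \<Rightarrow> (arm \<Rightarrow> real) \<Rightarrow> (arm \<Rightarrow> real) \<Rightarrow> arm list \<Rightarrow> real" where
  "pattern_mean_payout J p \<mu> D =
    (let r = count_list D A; s = count_list D B
     in (real r * \<mu> A + real s * \<mu> B) / real (r + s) + real J * futurity_freq J p D)"

definition parrondo_effect ::
    "nat \<Rightarrow> (arm \<Rightarrow> real) \<Rightarrow> (arm \<Rightarrow> real) \<Rightarrow> arm list \<Rightarrow> bool" where
  "parrondo_effect J p \<mu> D \<longleftrightarrow>
    (let r = count_list D A; s = count_list D B
     in pattern_mean_payout J p \<mu> D
          < (real r * arm_mean_payout J p \<mu> A + real s * arm_mean_payout J p \<mu> B) / real (r + s))"

end

theory Submission
  imports Defs "HOL-Analysis.Convex"
begin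

text \<open>
  In the variable \<open>x = - ln q\<close>, the award rate of a single arm is
  \<open>F x = (1 - exp (- x)) / (exp (J x) - 1) = 1 / (\<Sum>k=1..J. exp (k x))\<close>,
  and the frequency for a pattern involves the weighted mean \<open>m\<close> of the two values of \<open>x\<close>:
  it is \<open>F m\<close> with \<open>1 - exp (- m)\<close> replaced by the weighted mean of the two values
  of \<open>1 - exp (- x)\<close>. By strict convexity of \<open>exp\<close> this replacement strictly lowers the value, and
  \<open>F m\<close> is at most the weighted mean of the values of \<open>F\<close>, as \<open>F\<close> is convex.
  Convexity of \<open>F = 1 / S\<close> means \<open>S S'' \<le> 2 S'\<^sup>2\<close>, which is proved by induction on \<open>J\<close>,
  with Chebyshev's sum inequality for the induction step.
\<close>

text \<open>With \<open>N = Suc n\<close>, the coefficients \<open>4 N k - N^2 - k^2\<close>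
  increase for \<open>k \<le> n\<close>, as do the powers of \<open>w\<close>. By Chebyshev the
  weighted sum is at least the plain coefficient sum times the mean power, and that plain sum is
  nonnegative.\<close>

lemma sum_geometric_quadratic_nonneg:
  fixes w :: real
  assumes "1 \<le> w"
  shows "0 \<le> (\<Sum>k=1..n. (4 * real (Suc n) * real k - real (Suc n) ^ 2 - real k ^ 2) * w ^ k)"
proof -
  define c where "c k = 4 * real (Suc n) * real (Suc k) - real (Suc n) ^ 2 - real (Suc k) ^ 2" for k
  have c_mono: "c i \<le> c j" if "i \<le> j" "j < n" for i j
  proof -
    have "c j - c i = (real j - real i) * (4 * real (Suc n) - real (Suc i) - real (Suc j))"
      by (simp add: c_def algebra_simps power2_eq_square)
    also have "\<dots> \<ge> 0"
      using that by (intro mult_nonneg_nonneg) auto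
    finally show ?thesis by simp
  qed
  \<comment> \<open>The upper limit \<open>m\<close> is separated from the \<open>n\<close> inside
    \<open>c\<close> so that induction applies.\<close>
  have sum_c: "(\<Sum>k=0..<m. c k) = 2 * real (Suc n) * real m * real (Suc m)
      - real (Suc n) ^ 2 * real m - real m * real (Suc m) * (2 * real m + 1) / 6" for m
    by (induction m) (simp_all add: c_def field_simps power2_eq_square)
  have "0 \<le> real n * real (Suc n) * (4 * real n + 5) / 6"
    by simp
  also have "\<dots> = (\<Sum>k=0..<n. c k)"
    unfolding sum_c by (simp add: field_simps power2_eq_square)
  finally have "0 \<le> (\<Sum>k=0..<n. c k) * (\<Sum>k=0..<n. w ^ Suc k)"
    using assms by (intro mult_nonneg_nonneg sum_nonneg[of _ "\<lambda>k. w ^ Suc k"]) auto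
  \<comment> \<open>\<open>Chebyshev_sum_upper\<close> takes oppositely ordered sequences, hence the
    negated powers.\<close>
  also have "\<dots> \<le> real n * (\<Sum>k=0..<n. c k * w ^ Suc k)"
    using Chebyshev_sum_upper[of n c "\<lambda>k. - (w ^ Suc k)"] assms
    by (auto simp: c_mono power_increasing sum_negf simp del: power_Suc)
  finally have "0 \<le> (\<Sum>k=0..<n. c k * w ^ Suc k)"
    by (cases "n = 0") (auto simp: zero_le_mult_iff)
  also have "\<dots> = (\<Sum>k=1..n. (4 * real (Suc n) * real k - real (Suc n) ^ 2 - real k ^ 2) * w ^ k)"
    unfolding c_def by (simp only: One_nat_def sum.atLeast1_atMost_eq lessThan_atLeast0)
  finally show ?thesis .
qed

text \<open>Adding the term \<open>W = w ^ N\<close> with \<open>N = Suc n\<close> increases right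
  side minus left side by \<open>W * (4 N S1 - N^2 S0 - S2) + (N W)^2\<close>; the bracket is the
  quadratic sum bounded above.\<close>

lemma sum_geometric_second_moment_le:
  fixes w :: real
  assumes "1 \<le> w"
  shows "(\<Sum>k=1..n. w ^ k) * (\<Sum>k=1..n. real k ^ 2 * w ^ k) \<le> 2 * (\<Sum>k=1..n. real k * w ^ k) ^ 2"
proof (induction n)
  case 0
  show ?case by simp
next
  case (Suc n)
  define S0 S1 S2 where "S0 = (\<Sum>k=1..n. w ^ k)" and "S1 = (\<Sum>k=1..n. real k * w ^ k)"
    and "S2 = (\<Sum>k=1..n. real k ^ 2 * w ^ k)"
  define N W where "N = real (Suc n)" and "W = w ^ Suc n"
  have "0 \<le> (\<Sum>k=1..n. (4 * N * real k - N ^ 2 - real k ^ 2) * w ^ k)"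
    unfolding N_def by (rule sum_geometric_quadratic_nonneg[OF assms])
  also have "\<dots> = 4 * N * S1 - N ^ 2 * S0 - S2"
    by (simp add: S0_def S1_def S2_def sum_distrib_left sum_subtractf sum.distrib algebra_simps)
  finally have "0 \<le> W * (4 * N * S1 - N ^ 2 * S0 - S2) + (N * W) ^ 2"
    using assms by (intro add_nonneg_nonneg mult_nonneg_nonneg) (auto simp: W_def)
  moreover have "S0 * S2 \<le> 2 * S1 ^ 2"
    using Suc.IH by (simp add: S0_def S1_def S2_def)
  ultimately have "(S0 + W) * (S2 + N ^ 2 * W) \<le> 2 * (S1 + N * W) ^ 2"
    by (simp add: algebra_simps power2_eq_square)
  then show ?case
    by (simp add: S0_def S1_def S2_def N_def W_def)
qed

lemma convex_on_inverse_sum_exp: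
  assumes "1 \<le> n"
  shows "convex_on {0..} (\<lambda>x::real. inverse (\<Sum>k=1..n. exp x ^ k))"
proof -
  \<comment> \<open>\<open>S d\<close> is the \<open>d\<close>-th derivative of \<open>S 0\<close>,
    so the second derivative of \<open>1 / S 0\<close> is
    \<open>(2 (S 1)^2 - S 0 * S 2) / (S 0)^3\<close>. On \<open>{0..}\<close> the moment inequality
    applies with \<open>w = exp x \<ge> 1\<close>.\<close>
  define S where "S d x = (\<Sum>k=1..n. real k ^ d * exp x ^ k)" for d :: nat and x :: real
  have S_deriv: "(S d has_real_derivative S (Suc d) x) (at x)" for d x
  proof -
    have power_exp_deriv: "((\<lambda>x. exp x ^ k) has_real_derivative real k * exp x ^ k) (at x)" for k
      by (auto intro!: derivative_eq_intros simp flip: exp_of_nat_mult)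
    have "((\<lambda>x. real k ^ d * exp x ^ k) has_real_derivative real k ^ Suc d * exp x ^ k) (at x)" for k
      using DERIV_cmult[of "\<lambda>x. exp x ^ k" "real k * exp x ^ k" x UNIV "real k ^ d"]
        power_exp_deriv
      by (simp add: mult_ac)
    then show ?thesis
      unfolding S_def by (intro DERIV_sum)
  qed
  have S0_pos: "S 0 x > 0" for x
    unfolding S_def using assms by (intro sum_pos) auto
  have "convex_on {0..} (\<lambda>x. inverse (S 0 x))"
  proof (rule f''_ge0_imp_convex)
    fix x :: real
    show "((\<lambda>x. inverse (S 0 x)) has_real_derivative - S 1 x / S 0 x ^ 2) (at x)"
      using S0_pos[of x]
      by (auto intro!: derivative_eq_intros S_deriv simp: power2_eq_square field_simps)
    show "((\<lambda>x. - S 1 x / S 0 x ^ 2) has_real_derivative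
        (2 * S 1 x ^ 2 - S 0 x * S 2 x) / S 0 x ^ 3) (at x)"
      using S0_pos[of x] S_deriv[of 1 x]
      by (auto intro!: derivative_eq_intros S_deriv
          simp: power2_eq_square power3_eq_cube field_simps numeral_2_eq_2)
    assume "x \<in> {0..}"
    then have "S 0 x * S 2 x \<le> 2 * S 1 x ^ 2"
      using sum_geometric_second_moment_le[of "exp x" n] by (simp add: S_def)
    then show "0 \<le> (2 * S 1 x ^ 2 - S 0 x * S 2 x) / S 0 x ^ 3"
      using S0_pos[of x] by simp
  qed auto
  then show ?thesis by (simp add: S_def)
qed

lemma inverse_sum_exp_eq:
  fixes x :: real
  assumes "0 < x" "1 \<le> n"
  shows "inverse (\<Sum>k=1..n. exp x ^ k) = (1 - exp (- x)) * exp (- x) ^ n / (1 - exp (- x) ^ n)"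
proof -
  define q where "q = exp (- x)"
  have q: "0 < q" "q < 1" and exp_eq: "exp x = inverse q"
    using assms by (simp_all add: q_def flip: exp_minus)
  \<comment> \<open>The factor \<open>q ^ n\<close> turns the sum into
    \<open>1 + q + ... + q ^ (n - 1)\<close>, which \<open>1 - q\<close> telescopes.\<close>
  have "(1 - q) * q ^ n * (\<Sum>k=1..n. inverse q ^ k) = 1 - q ^ n" for n
  proof (induction n)
    case (Suc n)
    have "(1 - q) * q ^ Suc n * (\<Sum>k=1..Suc n. inverse q ^ k)
        = q * ((1 - q) * q ^ n * (\<Sum>k=1..n. inverse q ^ k)) + (1 - q) * (q ^ Suc n * inverse q ^ Suc n)"
      by (simp add: algebra_simps)
    also have "\<dots> = 1 - q ^ Suc n"
      unfolding Suc.IH using q by (simp add: algebra_simps flip: power_mult_distrib)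
    finally show ?case .
  qed simp
  from this[of n] have "(1 - q) * q ^ n * (\<Sum>k=1..n. exp x ^ k) = 1 - q ^ n"
    by (simp add: exp_eq)
  moreover have "q ^ n < 1"
    using q assms by (simp add: power_less_one_iff)
  ultimately show ?thesis
    unfolding q_def[symmetric] using q
    by (metis (no_types, lifting) inverse_divide inverse_eq_divide nonzero_mult_div_cancel_left
        mult_eq_0_iff less_irrefl diff_gt_0_iff_gt zero_less_power)
qed

text \<open>The tangent at the mean \<open>m\<close> lies strictly below \<open>exp\<close> away
  from \<open>m\<close>, and averaging its values at \<open>x\<close> and \<open>y\<close> gives
  back \<open>exp m\<close>.\<close>

lemma exp_strict_convex:
  fixes x y t :: real
  assumes "x \<noteq> y" "0 < t" "t < 1"
  shows "exp ((1 - t) * x + t * y) < (1 - t) * exp x + t * exp y"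
proof -
  define m where "m = (1 - t) * x + t * y"
  have tangent: "exp m * (1 + (z - m)) < exp z" if "z \<noteq> m" for z
  proof -
    have "exp m * (1 + (z - m)) < exp m * exp (z - m)"
      using that exp_minus_greater[of "m - z"] by (intro mult_strict_left_mono) auto
    then show ?thesis by (simp flip: exp_add)
  qed
  have "x - m = t * (x - y)" "y - m = (1 - t) * (y - x)"
    by (simp_all add: m_def algebra_simps)
  then have "x \<noteq> m" "y \<noteq> m"
    using assms by auto
  have "exp m = (1 - t) * (exp m * (1 + (x - m))) + t * (exp m * (1 + (y - m)))"
    by (simp add: m_def algebra_simps)
  also have "\<dots> < (1 - t) * exp x + t * exp y"
    using assms tangent[OF \<open>x \<noteq> m\<close>] tangent[OF \<open>y \<noteq> m\<close>]
    by (intro add_strict_mono mult_strict_left_mono) auto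
  finally show ?thesis by (simp add: m_def)
qed

lemma award_freq_less:
  fixes x y t :: real
  assumes "0 < x" "0 < y" "x \<noteq> y" "0 < t" "t < 1" "1 \<le> n"
  defines "Q \<equiv> exp (- ((1 - t) * x + t * y)) ^ n"
  shows "((1 - t) * (1 - exp (- x)) + t * (1 - exp (- y))) * (Q / (1 - Q))
    < (1 - t) * ((1 - exp (- x)) * exp (- x) ^ n / (1 - exp (- x) ^ n))
      + t * ((1 - exp (- y)) * exp (- y) ^ n / (1 - exp (- y) ^ n))"
proof -
  define m where "m = (1 - t) * x + t * y"
  have "0 < m"
    unfolding m_def using assms by (intro add_pos_pos mult_pos_pos) auto
  have Q: "Q = exp (- m) ^ n" "0 < Q" "Q < 1"
    using \<open>0 < m\<close> \<open>1 \<le> n\<close> by (simp_all add: Q_def m_def power_less_one_iff)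
  \<comment> \<open>The strict inequality of the conclusion arises here, from
    \<open>x \<noteq> y\<close>.\<close>
  have "exp (- m) < (1 - t) * exp (- x) + t * exp (- y)"
    using exp_strict_convex[of "- x" "- y" t] assms by (simp add: m_def algebra_simps)
  then have "(1 - t) * (1 - exp (- x)) + t * (1 - exp (- y)) < 1 - exp (- m)"
    by (simp add: algebra_simps)
  then have "((1 - t) * (1 - exp (- x)) + t * (1 - exp (- y))) * (Q / (1 - Q))
      < (1 - exp (- m)) * (Q / (1 - Q))"
    using Q by (intro mult_strict_right_mono) auto
  also have "\<dots> = inverse (\<Sum>k=1..n. exp m ^ k)"
    using inverse_sum_exp_eq[OF \<open>0 < m\<close> \<open>1 \<le> n\<close>] by (simp add: Q)
  also have "\<dots> \<le> (1 - t) * inverse (\<Sum>k=1..n. exp x ^ k) + t * inverse (\<Sum>k=1..n. exp y ^ k)"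
    using convex_onD[OF convex_on_inverse_sum_exp[OF \<open>1 \<le> n\<close>], of t x y] assms
    by (simp add: m_def)
  finally show ?thesis
    using assms by (simp only: inverse_sum_exp_eq)
qed

theorem theorem5:
  fixes p \<mu> :: "arm \<Rightarrow> real" and J r s :: nat and D :: "arm list"
  assumes "0 < p A" "p A < 1" "0 < p B" "p B < 1"
    and "0 \<le> \<mu> A" "0 \<le> \<mu> B"
    and "count_list D A = r" "count_list D B = s"
    and "p A \<noteq> p B"
    and "2 \<le> J" "1 \<le> r" "1 \<le> s"
    and "(r + s) dvd J"
  shows "parrondo_effect J p \<mu> D"
proof -
  define x y t where "x = - ln (1 - p A)" and "y = - ln (1 - p B)" and "t = real s / real (r + s)"
  define qA qB Q where "qA = 1 - p A" and "qB = 1 - p B"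
    and "Q = (qA ^ r * qB ^ s) ^ (J div (r + s))"
  have exp_xy: "exp (- x) = qA" "exp (- y) = qB"
    using assms by (simp_all add: x_def y_def qA_def qB_def)
  have t: "0 < t" "t < 1" "1 - t = real r / real (r + s)"
    using assms by (simp_all add: t_def field_simps)
  obtain k where k: "J = (r + s) * k"
    using \<open>(r + s) dvd J\<close> by blast
  have "real (r + s) * (- ((1 - t) * x + t * y)) = real r * (- x) + real s * (- y)"
    using \<open>1 \<le> r\<close> unfolding t(3) unfolding t_def by (simp add: divide_simps)
  \<comment> \<open>\<open>exp (- m)\<close> is the weighted geometric mean of \<open>qA\<close> and
    \<open>qB\<close>; since \<open>r + s\<close> divides \<open>J\<close>, its \<open>J\<close>-th
    power is exactly \<open>Q\<close>.\<close>
  then have "exp (- ((1 - t) * x + t * y)) ^ (r + s) = qA ^ r * qB ^ s"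
    by (simp only: exp_add exp_of_nat_mult exp_xy flip: exp_of_nat_mult[of "r + s"])
  then have Q: "exp (- ((1 - t) * x + t * y)) ^ J = Q"
    using assms by (simp add: Q_def k power_mult)
  have xy: "0 < x" "0 < y" "x \<noteq> y"
    using assms by (simp_all add: x_def y_def)
  have "((1 - t) * p A + t * p B) * (Q / (1 - Q))
      < (1 - t) * (p A * qA ^ J / (1 - qA ^ J)) + t * (p B * qB ^ J / (1 - qB ^ J))"
    using award_freq_less[OF xy t(1,2), of J] \<open>2 \<le> J\<close>
    unfolding Q exp_xy by (simp add: qA_def qB_def)
  then have "real J * (((1 - t) * p A + t * p B) * (Q / (1 - Q)))
      < real J * ((1 - t) * (p A * qA ^ J / (1 - qA ^ J)) + t * (p B * qB ^ J / (1 - qB ^ J)))"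
    using \<open>2 \<le> J\<close> by (intro mult_strict_left_mono) auto
  moreover have mean: "(real r * a + real s * b) / real (r + s) = (1 - t) * a + t * b" for a b
    unfolding t(3) unfolding t_def by (simp add: add_divide_distrib)
  \<comment> \<open>Once every average is written with weights \<open>1 - t\<close> and
    \<open>t\<close>, the \<open>\<mu>\<close> terms agree on both sides and cancel.\<close>
  ultimately show ?thesis
    unfolding parrondo_effect_def pattern_mean_payout_def futurity_freq_def arm_mean_payout_def
      Let_def assms(7,8) mean
    unfolding qA_def[symmetric] qB_def[symmetric] Q_def[symmetric]
    by (simp add: algebra_simps)
qed

end
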